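(* For any graph $G$ with $n$ vertices, \[ \chi_{\mathrm{vec}}(G) \geq \frac{\vartheta\left(\overline{G}\right)^2}{n}. \]
   Context: Graphs are finite, simple and nonempty; $\overline{G}$ is the complement of $G$. Let $R$ be a (finite-dimensional real) Euclidean space with inner product $\langle\cdot,\cdot\rangle$. An orthonormal representation of a graph $G$ in $R$ is a map $f: V(G)\to R$ such that every $f(v)$ is a unit vector and $\langle f(u), f(v)\rangle = 0$ for all distinct $u,v\in V(G)$ with $uv\notin E(G)$. The Lovász theta function $\vartheta(G)$ is the maximum, over all orthonormal representations $f$ of the complement $\overline{G}$, of the largest eigenvalue $\lambda_1(M)$ of the Gram matrix $M\in\mathbb{R}^{V(G)\times V(G)}$, $M(u,v)=\langle f(u),f(v)\rangle$. (Thus $\vartheta(\overline{G})$ is the maximum of $\lambda_1(M)$ over Gram matrices $M$ of orthonormal representations of $G$.) The vector chromatic number $\chi_{\mathrm{vec}}(G)$ is the minimum $\kappa\geq 2$ (a real number) for which there exist a Euclidean space $R$ and an assignment of unit vectors $f: V(G)\to R$ such that $\langle f(u),f(v)\rangle \leq \frac{-1}{\kappa-1}$ for all edges $uv\in E(G)$. *)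

theory Defs
  imports
    Complex_Main
    "Graph_Theory.Pair_Digraph"
    "Jordan_Normal_Form.Matrix"
begin

text \<open>
  Simple graphs are the finite, symmetric, loop-free digraphs of the locale
  \<^locale>\<open>pair_graph\<close>; the edge uv is the pair of arcs (u, v), (v, u).
  A finite-dimensional Euclidean space is represented by its coordinate space
  \<^term>\<open>carrier_vec d :: real vec set\<close>, so that the dimension d can be quantified
  inside a formula.
\<close>

definition graph_complement :: "'a pair_pre_digraph \<Rightarrow> 'a pair_pre_digraph" where
  "graph_complement G =
     \<lparr>pverts = pverts G,
      parcs = {(u, v). u \<in> pverts G \<and> v \<in> pverts G \<and> u \<noteq> v \<and> (u, v) \<notin> parcs G}\<rparr>"

definition unit_assignment :: "nat \<Rightarrow> 'a pair_pre_digraph \<Rightarrow> ('a \<Rightarrow> real vec) \<Rightarrow> bool" where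
  "unit_assignment d G f \<longleftrightarrow>
     (\<forall>v\<in>pverts G. f v \<in> carrier_vec d \<and> sqrt (f v \<bullet> f v) = 1)"

definition orthonormal_rep :: "nat \<Rightarrow> 'a pair_pre_digraph \<Rightarrow> ('a \<Rightarrow> real vec) \<Rightarrow> bool" where
  "orthonormal_rep d G f \<longleftrightarrow>
     unit_assignment d G f \<and>
     (\<forall>u\<in>pverts G. \<forall>v\<in>pverts G. u \<noteq> v \<and> (u, v) \<notin> parcs G \<longrightarrow> f u \<bullet> f v = 0)"

definition gram_matrix :: "('a \<Rightarrow> real vec) \<Rightarrow> 'a \<Rightarrow> 'a \<Rightarrow> real" where
  "gram_matrix f u v = f u \<bullet> f v"

text \<open>
  Real matrices with rows and columns indexed by a finite set V are functions of two
  arguments, and vectors indexed by V are functions of one argument; only the values on V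
  matter, so being a nonzero vector means being nonzero somewhere on V.
\<close>

definition indexed_eigenvalue :: "'a set \<Rightarrow> ('a \<Rightarrow> 'a \<Rightarrow> real) \<Rightarrow> real \<Rightarrow> bool" where
  "indexed_eigenvalue V M l \<longleftrightarrow>
     (\<exists>x. (\<exists>v\<in>V. x v \<noteq> 0) \<and> (\<forall>u\<in>V. (\<Sum>v\<in>V. M u v * x v) = l * x u))"

text \<open>
  A real symmetric matrix over a finite nonempty index set has a finite nonempty set of real
  eigenvalues, so the maximum below is meaningful for Gram matrices.
\<close>

definition largest_eigenvalue :: "'a set \<Rightarrow> ('a \<Rightarrow> 'a \<Rightarrow> real) \<Rightarrow> real" where
  "largest_eigenvalue V M = Max {l. indexed_eigenvalue V M l}"

text \<open>
  In the next two definitions the supremum and the infimum are attained (by compactness),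
  i.e. they are the maximum and the minimum.
\<close>

definition lovasz_theta :: "'a pair_pre_digraph \<Rightarrow> real" where
  "lovasz_theta G =
     Sup {largest_eigenvalue (pverts G) (gram_matrix f) | d f.
            orthonormal_rep d (graph_complement G) f}"

definition vector_chromatic_number :: "'a pair_pre_digraph \<Rightarrow> real" where
  "vector_chromatic_number G =
     Inf {\<kappa>. \<kappa> \<ge> 2 \<and>
            (\<exists>d f. unit_assignment d G f \<and>
               (\<forall>(u, v)\<in>parcs G. f u \<bullet> f v \<le> - 1 / (\<kappa> - 1)))}"

end

theory Submission
  imports Defs "HOL-Analysis.Convex" "Jordan_Normal_Form.Spectral_Radius"
begin

text \<open>
  Let \<open>M\<close> be the Gram matrix of an orthonormal representation of \<open>G\<close> and \<open>N\<close> the Gram matrix of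
  unit vectors that witness a value \<open>\<kappa>\<close> for the vector chromatic number. The theorem holds because
  the Frobenius norm of \<open>M\<close> is squeezed between the two graph parameters.

  From below, every eigenvalue \<open>l\<close> of \<open>M\<close> satisfies \<open>l\<^sup>2 \<le> \<Sum>u v. M(u,v)\<^sup>2\<close> by the
  Cauchy-Schwarz inequality (\<open>eigenvalue_square_le_sum_squares\<close>).

  From above, the entrywise product of the positive semidefinite matrices \<open>M\<close>, \<open>M\<close>, \<open>N\<close> is
  again positive semidefinite, so testing it against the all-ones vector gives
  \<open>\<Sum>u v. M(u,v)\<^sup>2 N(u,v) \<ge> 0\<close> (\<open>sum_gram_Schur_product_nonneg\<close>). Squaring \<open>M\<close> makes the
  weights nonnegative, which is what makes a one-sided bound on \<open>N\<close> usable.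
  The diagonal contributes \<open>n\<close>, the non-adjacent pairs contribute nothing because \<open>M\<close> vanishes
  there, and on arcs \<open>N(u,v) \<le> -1/(\<kappa>-1)\<close>. Hence the sum of \<open>M(u,v)\<^sup>2\<close> over the arcs is at most
  \<open>(\<kappa>-1) n\<close>, and \<open>\<Sum>u v. M(u,v)\<^sup>2 \<le> \<kappa> n\<close> (\<open>sum_gram_squares_le\<close>).

  Together \<open>l\<^sup>2 \<le> \<kappa> n\<close>; taking the supremum over \<open>M\<close> and the infimum over \<open>\<kappa>\<close> gives the claim.
  As the parameters are defined through \<open>Max\<close>, \<open>Sup\<close> and \<open>Inf\<close>, it must also be shown that
  the sets involved are nonempty and, for \<open>Max\<close>, finite: a Gram matrix has finitely many
  real eigenvalues and at least one, every graph has an orthonormal representation (by standard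
  basis vectors), and every nonempty graph has a vector colouring (by a regular simplex).
\<close>

(* From here on the infix bullet denotes only the scalar product of coordinate vectors. *)
unbundle no inner_syntax

section \<open>Eigenvalues of matrices indexed by a finite set\<close>

text \<open>
  Enumerating the index set turns an indexed matrix into one with numbered rows and columns, to
  which the theory of characteristic polynomials applies. The entries range over an arbitrary field
  because the existence of an eigenvalue is obtained over the complex numbers.
\<close>

lemma eigenvalue_mat_iff:
  fixes M :: "'a \<Rightarrow> 'a \<Rightarrow> 'b::field"
  assumes e: "bij_betw e {0..<n} V"
  shows "eigenvalue (mat n n (\<lambda>(i, j). M (e i) (e j))) l \<longleftrightarrow>
    (\<exists>x. (\<exists>v\<in>V. x v \<noteq> 0) \<and> (\<forall>u\<in>V. (\<Sum>v\<in>V. M u v * x v) = l * x u))"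
    (is "eigenvalue ?A l \<longleftrightarrow> ?R")
proof
  have V: "V = e ` {0..<n}" and inj: "inj_on e {0..<n}"
    using e by (auto simp: bij_betw_def)
  have sum_V: "(\<Sum>v\<in>V. h v) = (\<Sum>j<n. h (e j))" for h :: "'a \<Rightarrow> 'b"
    unfolding V using inj by (simp add: sum.reindex atLeast0LessThan)
  {
    assume "eigenvalue ?A l"
    then obtain w where w: "w \<in> carrier_vec n" "w \<noteq> 0\<^sub>v n" "?A *\<^sub>v w = l \<cdot>\<^sub>v w"
      unfolding eigenvalue_def eigenvector_def by auto
    define x where "x v = w $ (the_inv_into {0..<n} e v)" for v
    have x_e: "x (e i) = w $ i" if "i < n" for i
      using that inj by (simp add: x_def the_inv_into_f_f)
    have "\<exists>i<n. w $ i \<noteq> 0"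
      using w(1,2) by (metis eq_vecI carrier_vecD index_zero_vec(1,2))
    then have "\<exists>v\<in>V. x v \<noteq> 0"
      unfolding V using x_e by fastforce
    moreover have "(\<Sum>v\<in>V. M u v * x v) = l * x u" if "u \<in> V" for u
    proof -
      obtain i where i: "i < n" "u = e i" using \<open>u \<in> V\<close> unfolding V by auto
      have "(?A *\<^sub>v w) $ i = (l \<cdot>\<^sub>v w) $ i" using w(3) by simp
      then show ?thesis
        using i w(1) by (simp add: sum_V x_e scalar_prod_def atLeast0LessThan)
    qed
    ultimately show ?R by blast
  next
    assume ?R
    then obtain x where x: "\<exists>v\<in>V. x v \<noteq> 0"
      "\<And>u. u \<in> V \<Longrightarrow> (\<Sum>v\<in>V. M u v * x v) = l * x u" by blast
    define w where "w = vec n (\<lambda>i. x (e i))"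
    have "w \<noteq> 0\<^sub>v n"
    proof
      assume "w = 0\<^sub>v n"
      then have "x (e i) = 0" if "i < n" for i
        using that by (metis w_def index_vec index_zero_vec(1))
      then show False using x(1) unfolding V by auto
    qed
    moreover have "?A *\<^sub>v w = l \<cdot>\<^sub>v w"
    proof (rule eq_vecI)
      fix i assume "i < dim_vec (l \<cdot>\<^sub>v w)"
      then have i: "i < n" by (simp add: w_def)
      then have "e i \<in> V" by (simp add: V)
      from x(2)[OF this] show "(?A *\<^sub>v w) $ i = (l \<cdot>\<^sub>v w) $ i"
        using i by (simp add: sum_V w_def scalar_prod_def atLeast0LessThan)
    qed (simp add: w_def)
    ultimately show "eigenvalue ?A l"
      unfolding eigenvalue_def eigenvector_def by (auto simp: w_def intro!: exI[of _ w])
  }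
qed

lemma finite_indexed_eigenvalues:
  assumes "finite V"
  shows "finite {l. indexed_eigenvalue V M l}"
proof -
  obtain e where e: "bij_betw e {0..<card V} V"
    using ex_bij_betw_nat_finite[OF assms] by blast
  let ?A = "mat (card V) (card V) (\<lambda>(i, j). M (e i) (e j))"
  have "{l. indexed_eigenvalue V M l} = spectrum ?A"
    unfolding spectrum_def indexed_eigenvalue_def
    by (intro Collect_cong eigenvalue_mat_iff[OF e, of M, symmetric])
  then show ?thesis
    using card_finite_spectrum(1)[of ?A "card V"] by simp
qed

text \<open>
  Over the complex numbers an eigenvector \<open>z\<close> with eigenvalue \<open>k\<close> always exists. By symmetry the
  Hermitian form \<open>q = z\<^sup>* M z = k |z|\<^sup>2\<close> equals its own conjugate, so \<open>k\<close> is real. The real and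
  imaginary parts of \<open>z\<close> then satisfy the eigenvalue equation separately, and one of
  them is nonzero.
\<close>

lemma symmetric_has_indexed_eigenvalue:
  assumes "finite V" "V \<noteq> {}"
    and sym: "\<And>u v. u \<in> V \<Longrightarrow> v \<in> V \<Longrightarrow> M u v = M v u"
  shows "\<exists>l. indexed_eigenvalue V M l"
proof -
  obtain e where e: "bij_betw e {0..<card V} V"
    using ex_bij_betw_nat_finite[OF assms(1)] by blast
  let ?A = "mat (card V) (card V) (\<lambda>(i, j). complex_of_real (M (e i) (e j)))"
  have "spectrum ?A \<noteq> {}"
    using assms(1,2) by (intro spectrum_non_empty[where n = "card V"]) (auto simp: card_gt_0_iff)
  then obtain k where "eigenvalue ?A k"
    by (auto simp: spectrum_def)
  then obtain z where z: "\<exists>v\<in>V. z v \<noteq> 0"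
    "\<And>u. u \<in> V \<Longrightarrow> (\<Sum>v\<in>V. complex_of_real (M u v) * z v) = k * z u"
    using eigenvalue_mat_iff[OF e, of "\<lambda>u v. complex_of_real (M u v)"] by blast
  define q where "q = (\<Sum>u\<in>V. \<Sum>v\<in>V. cnj (z u) * complex_of_real (M u v) * z v)"
  define r where "r = (\<Sum>u\<in>V. (cmod (z u))\<^sup>2)"
  have "cnj q = (\<Sum>u\<in>V. \<Sum>v\<in>V. cnj (z v) * complex_of_real (M v u) * z u)"
    unfolding q_def cnj_sum by (intro sum.cong refl) (simp add: sym mult_ac)
  also have "\<dots> = q"
    unfolding q_def by (rule sum.swap)
  finally have "Im q = 0"
    by (simp add: complex_eq_iff)
  have "q = (\<Sum>u\<in>V. cnj (z u) * (k * z u))"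
    unfolding q_def using z(2) by (simp add: sum_distrib_left[symmetric] mult.assoc)
  also have "\<dots> = k * complex_of_real r"
    unfolding r_def of_real_sum sum_distrib_left
    by (intro sum.cong refl) (simp add: complex_norm_square mult_ac del: of_real_power)
  finally have "q = k * complex_of_real r" .
  moreover obtain w where "w \<in> V" "z w \<noteq> 0" using z(1) by blast
  then have "r > 0"
    unfolding r_def using assms(1) by (intro sum_pos2[of V w]) auto
  ultimately have Im_k: "Im k = 0"
    using \<open>Im q = 0\<close> by simp
  have Re_z: "(\<Sum>v\<in>V. M u v * Re (z v)) = Re k * Re (z u)" if "u \<in> V" for u
    using arg_cong[OF z(2)[OF that], of Re] by (simp add: Im_k)
  have Im_z: "(\<Sum>v\<in>V. M u v * Im (z v)) = Re k * Im (z u)" if "u \<in> V" for u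
    using arg_cong[OF z(2)[OF that], of Im] by (simp add: Im_k)
  from z(1) have "(\<exists>v\<in>V. Re (z v) \<noteq> 0) \<or> (\<exists>v\<in>V. Im (z v) \<noteq> 0)"
    by (auto simp: complex_eq_iff)
  then have "indexed_eigenvalue V M (Re k)"
    unfolding indexed_eigenvalue_def
  proof
    assume "\<exists>v\<in>V. Re (z v) \<noteq> 0"
    then show "\<exists>x. (\<exists>v\<in>V. x v \<noteq> 0) \<and> (\<forall>u\<in>V. (\<Sum>v\<in>V. M u v * x v) = Re k * x u)"
      using Re_z by (intro exI[of _ "\<lambda>v. Re (z v)"]) blast
  next
    assume "\<exists>v\<in>V. Im (z v) \<noteq> 0"
    then show "\<exists>x. (\<exists>v\<in>V. x v \<noteq> 0) \<and> (\<forall>u\<in>V. (\<Sum>v\<in>V. M u v * x v) = Re k * x u)"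
      using Im_z by (intro exI[of _ "\<lambda>v. Im (z v)"]) blast
  qed
  then show ?thesis by blast
qed

lemma largest_eigenvalue_is_eigenvalue:
  assumes "finite V" "V \<noteq> {}"
    and "\<And>u v. u \<in> V \<Longrightarrow> v \<in> V \<Longrightarrow> M u v = M v u"
  shows "indexed_eigenvalue V M (largest_eigenvalue V M)"
  using Max_in[OF finite_indexed_eigenvalues[OF assms(1)], of M]
    symmetric_has_indexed_eigenvalue[OF assms]
  unfolding largest_eigenvalue_def by auto

text \<open>
  Apply the Cauchy-Schwarz inequality to each coordinate of \<open>M x = l x\<close>, and add up.
\<close>

lemma eigenvalue_square_le_sum_squares:
  assumes "finite V" "indexed_eigenvalue V M l"
  shows "l\<^sup>2 \<le> (\<Sum>u\<in>V. \<Sum>v\<in>V. (M u v)\<^sup>2)"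
proof -
  obtain x where x: "\<exists>v\<in>V. x v \<noteq> 0" "\<And>u. u \<in> V \<Longrightarrow> (\<Sum>v\<in>V. M u v * x v) = l * x u"
    using assms(2) unfolding indexed_eigenvalue_def by blast
  let ?s = "\<Sum>v\<in>V. (x v)\<^sup>2"
  obtain w where "w \<in> V" "x w \<noteq> 0" using x(1) by blast
  then have "?s > 0"
    using assms(1) by (intro sum_pos2[of V w]) auto
  have "l\<^sup>2 * ?s = (\<Sum>u\<in>V. (\<Sum>v\<in>V. M u v * x v)\<^sup>2)"
    using x(2) by (simp add: sum_distrib_left power_mult_distrib)
  also have "\<dots> \<le> (\<Sum>u\<in>V. (\<Sum>v\<in>V. (M u v)\<^sup>2) * ?s)"
    by (intro sum_mono Cauchy_Schwarz_ineq_sum)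
  also have "\<dots> = (\<Sum>u\<in>V. \<Sum>v\<in>V. (M u v)\<^sup>2) * ?s"
    by (simp add: sum_distrib_right)
  finally show ?thesis
    using \<open>?s > 0\<close> by simp
qed

section \<open>Gram matrices\<close>

lemma scalar_prod_carrier:
  assumes "b \<in> carrier_vec d"
  shows "a \<bullet> b = (\<Sum>i<d. a $ i * b $ i)"
  using assms by (simp add: scalar_prod_def atLeast0LessThan)

text \<open>
  The entrywise product of Gram matrices is the Gram matrix of the tensor products of the vectors,
  here \<open>f v \<otimes> f v \<otimes> g v\<close>, whose coordinates \<open>h p v\<close> are indexed by triples \<open>p\<close>. The sum of all
  its entries is therefore the squared length of \<open>\<Sum>v. f v \<otimes> f v \<otimes> g v\<close>.
\<close>

lemma sum_gram_Schur_product_nonneg: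
  fixes f g :: "'a \<Rightarrow> real vec"
  assumes f: "\<And>v. v \<in> V \<Longrightarrow> f v \<in> carrier_vec d"
    and g: "\<And>v. v \<in> V \<Longrightarrow> g v \<in> carrier_vec m"
  shows "0 \<le> (\<Sum>u\<in>V. \<Sum>v\<in>V. (f u \<bullet> f v)\<^sup>2 * (g u \<bullet> g v))"
proof -
  let ?P = "{..<d} \<times> {..<d} \<times> {..<m}"
  define h where "h = (\<lambda>(i, j, k) u. f u $ i * f u $ j * g u $ k)"
  have "(f u \<bullet> f v)\<^sup>2 * (g u \<bullet> g v) = (\<Sum>p\<in>?P. h p u * h p v)"
    if "u \<in> V" "v \<in> V" for u v
  proof -
    have "(f u \<bullet> f v)\<^sup>2 * (g u \<bullet> g v) =
        (\<Sum>i<d. f u $ i * f v $ i) * ((\<Sum>j<d. f u $ j * f v $ j) * (\<Sum>k<m. g u $ k * g v $ k))"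
      using that by (simp add: scalar_prod_carrier[OF f] scalar_prod_carrier[OF g] power2_eq_square)
    also have "\<dots> = (\<Sum>i<d. \<Sum>j<d. \<Sum>k<m.
        f u $ i * f v $ i * (f u $ j * f v $ j * (g u $ k * g v $ k)))"
      by (subst sum_product, subst sum_product) (simp only: sum_distrib_left)
    also have "\<dots> = (\<Sum>i<d. \<Sum>j<d. \<Sum>k<m. h (i, j, k) u * h (i, j, k) v)"
      by (intro sum.cong refl) (simp add: h_def mult_ac)
    also have "\<dots> = (\<Sum>p\<in>?P. h p u * h p v)"
      by (simp only: sum.cartesian_product')
    finally show ?thesis .
  qed
  then have "(\<Sum>u\<in>V. \<Sum>v\<in>V. (f u \<bullet> f v)\<^sup>2 * (g u \<bullet> g v)) =
      (\<Sum>u\<in>V. \<Sum>v\<in>V. \<Sum>p\<in>?P. h p u * h p v)"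
    by simp
  also have "\<dots> = (\<Sum>u\<in>V. \<Sum>p\<in>?P. \<Sum>v\<in>V. h p u * h p v)"
    by (intro sum.cong refl sum.swap)
  also have "\<dots> = (\<Sum>p\<in>?P. \<Sum>u\<in>V. \<Sum>v\<in>V. h p u * h p v)"
    by (rule sum.swap)
  also have "\<dots> = (\<Sum>p\<in>?P. (\<Sum>u\<in>V. h p u)\<^sup>2)"
    by (simp add: power2_eq_square sum_product)
  also have "\<dots> \<ge> 0"
    by (intro sum_nonneg) simp
  finally show ?thesis .
qed

text \<open>
  The vertices are the standard basis vectors moved so that their centroid is the origin,
  and then normalised: \<open>c = 1/N\<close> is each coordinate of the centroid, and
  \<open>sqrt (1 - c)\<close> is the distance of a basis vector from it.
\<close>

lemma regular_simplex:
  assumes "N \<ge> 2"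
  obtains s :: "nat \<Rightarrow> real vec"
  where "\<And>i. s i \<in> carrier_vec N"
    and "\<And>i. i < N \<Longrightarrow> s i \<bullet> s i = 1"
    and "\<And>i j. i < N \<Longrightarrow> j < N \<Longrightarrow> i \<noteq> j \<Longrightarrow> s i \<bullet> s j = - 1 / (real N - 1)"
proof -
  define c where "c = 1 / real N"
  have c: "c < 1" "real N * c = 1" using assms by (auto simp: c_def)
  define \<delta> where "\<delta> i k = (if k = i then 1 else 0 :: real)" for i k :: nat
  define s where "s i = vec N (\<lambda>k. (\<delta> i k - c) / sqrt (1 - c))" for i
  have prod: "s i \<bullet> s j = ((if i = j then 1 else 0) - c) / (1 - c)" if "i < N" "j < N" for i j
  proof -
    have "s i \<bullet> s j = (\<Sum>k<N. (\<delta> i k - c) * (\<delta> j k - c) / (1 - c))"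
      using c by (simp add: s_def scalar_prod_def atLeast0LessThan)
    also have "\<dots> = (\<Sum>k<N. \<delta> i k * \<delta> j k - c * \<delta> i k - c * \<delta> j k + c * c) / (1 - c)"
      by (simp add: sum_divide_distrib algebra_simps)
    also have "(\<Sum>k<N. \<delta> i k * \<delta> j k - c * \<delta> i k - c * \<delta> j k + c * c) =
        (\<Sum>k<N. \<delta> i k * \<delta> j k) - c * (\<Sum>k<N. \<delta> i k) - c * (\<Sum>k<N. \<delta> j k) + (real N * c) * c"
      by (simp add: sum.distrib sum_subtractf sum_distrib_left)
    also have "(\<Sum>k<N. \<delta> i k * \<delta> j k) = \<delta> j i"
      using that by (simp add: \<delta>_def if_distrib[of "\<lambda>x. x * _"] cong: if_cong)
    also have "(\<Sum>k<N. \<delta> i k) = 1" using that by (simp add: \<delta>_def)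
    also have "(\<Sum>k<N. \<delta> j k) = 1" using that by (simp add: \<delta>_def)
    finally show ?thesis using c by (simp add: \<delta>_def)
  qed
  show thesis
  proof
    show "s i \<in> carrier_vec N" for i by (simp add: s_def)
    show "s i \<bullet> s i = 1" if "i < N" for i using prod[OF that that] c by simp
    show "s i \<bullet> s j = - 1 / (real N - 1)" if "i < N" "j < N" "i \<noteq> j" for i j
      using prod[OF that(1,2)] that(3) assms by (simp add: c_def field_simps)
  qed
qed

section \<open>Theta and the vector chromatic number\<close>

text \<open>
  Distinct vertices of \<open>G\<close> are sent to distinct vertices of a regular simplex. The simplex has one
  vertex more than \<open>G\<close>, so that it has at least two also when \<open>G\<close> is a single vertex.
\<close>

lemma vector_colouring_exists:
  assumes "pair_graph G" "pverts G \<noteq> {}"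
  shows "\<exists>\<kappa>\<ge>2. \<exists>d f. unit_assignment d G f \<and>
    (\<forall>(u, v)\<in>parcs G. f u \<bullet> f v \<le> - 1 / (\<kappa> - 1))"
proof -
  interpret pair_graph G by fact
  let ?N = "Suc (card (pverts G))"
  obtain e where e: "bij_betw e (pverts G) {0..<card (pverts G)}"
    using ex_bij_betw_finite_nat[OF pair_finite_verts] by blast
  have "?N \<ge> 2"
    using assms(2) pair_finite_verts by (simp add: Suc_le_eq card_gt_0_iff)
  then obtain s :: "nat \<Rightarrow> real vec" where s: "\<And>i. s i \<in> carrier_vec ?N"
    "\<And>i. i < ?N \<Longrightarrow> s i \<bullet> s i = 1"
    "\<And>i j. i < ?N \<Longrightarrow> j < ?N \<Longrightarrow> i \<noteq> j \<Longrightarrow> s i \<bullet> s j = - 1 / (real ?N - 1)"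
    by (rule regular_simplex) blast
  have e_less: "e v < ?N" if "v \<in> pverts G" for v
    using bij_betwE[OF e] that by fastforce
  have "unit_assignment ?N G (\<lambda>v. s (e v))"
    using s(1,2) e_less by (simp add: unit_assignment_def)
  moreover have "s (e u) \<bullet> s (e v) = - 1 / (real ?N - 1)" if "(u, v) \<in> parcs G" for u v
  proof -
    have "u \<in> pverts G" "v \<in> pverts G" "u \<noteq> v"
      using that wellformed[of "(u, v)"] no_loops' by auto
    moreover from this have "e u \<noteq> e v"
      using e by (auto simp: bij_betw_def inj_on_def)
    ultimately show ?thesis using s(3) e_less by blast
  qed
  ultimately show ?thesis
    using \<open>?N \<ge> 2\<close> by (intro exI[of _ "real ?N"] conjI exI[of _ ?N] exI[of _ "\<lambda>v. s (e v)"]) auto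
qed

lemma orthonormal_rep_exists:
  assumes "finite (pverts G)"
  shows "\<exists>d f. orthonormal_rep d G f"
proof -
  obtain e where e: "bij_betw e (pverts G) {0..<card (pverts G)}"
    using ex_bij_betw_finite_nat[OF assms] by blast
  then have "e v < card (pverts G)" if "v \<in> pverts G" for v
    using bij_betwE that by fastforce
  moreover have "e u \<noteq> e v" if "u \<in> pverts G" "v \<in> pverts G" "u \<noteq> v" for u v
    using e that by (auto simp: bij_betw_def inj_on_def)
  ultimately have "orthonormal_rep (card (pverts G)) G (\<lambda>v. unit_vec (card (pverts G)) (e v))"
    by (auto simp: orthonormal_rep_def unit_assignment_def)
  then show ?thesis by blast
qed

lemma orthonormal_rep_complement_complement:
  "orthonormal_rep d (graph_complement (graph_complement G)) f \<longleftrightarrow> orthonormal_rep d G f"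
  by (auto simp: orthonormal_rep_def unit_assignment_def graph_complement_def)

text \<open>
  Multiplied by \<open>\<kappa> - 1\<close>, each term of the nonnegative sum of \<open>sum_gram_Schur_product_nonneg\<close> is
  at most minus the square of the Gram entry of \<open>f\<close>, up to a correction \<open>\<kappa>\<close> on the diagonal, where
  the term is \<open>\<kappa> - 1\<close> and the square is \<open>1\<close>.
\<close>

lemma sum_gram_squares_le:
  assumes "pair_graph G"
    and f: "orthonormal_rep d G f"
    and g: "unit_assignment m G g"
    and \<kappa>: "\<kappa> \<ge> 2" "\<And>u v. (u, v) \<in> parcs G \<Longrightarrow> g u \<bullet> g v \<le> - 1 / (\<kappa> - 1)"
  shows "(\<Sum>u\<in>pverts G. \<Sum>v\<in>pverts G. (f u \<bullet> f v)\<^sup>2) \<le> \<kappa> * real (card (pverts G))"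
proof -
  interpret pair_graph G by fact
  let ?V = "pverts G"
  let ?S = "\<Sum>u\<in>?V. \<Sum>v\<in>?V. (f u \<bullet> f v)\<^sup>2"
  have f_carrier: "f v \<in> carrier_vec d" "f v \<bullet> f v = 1" if "v \<in> ?V" for v
    using f that by (auto simp: orthonormal_rep_def unit_assignment_def)
  have g_carrier: "g v \<in> carrier_vec m" "g v \<bullet> g v = 1" if "v \<in> ?V" for v
    using g that by (auto simp: unit_assignment_def)
  have entry: "(\<kappa> - 1) * ((f u \<bullet> f v)\<^sup>2 * (g u \<bullet> g v)) \<le>
      (if v = u then \<kappa> else 0) - (f u \<bullet> f v)\<^sup>2" if uv: "u \<in> ?V" "v \<in> ?V" for u v
  proof (cases "u = v")
    case True
    then show ?thesis using f_carrier g_carrier uv by simp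
  next
    case False
    show ?thesis
    proof (cases "(u, v) \<in> parcs G")
      case True
      then have "(\<kappa> - 1) * (g u \<bullet> g v) \<le> - 1"
        using \<kappa>(2)[OF True] \<kappa>(1) by (simp add: field_simps)
      then have "(f u \<bullet> f v)\<^sup>2 * ((\<kappa> - 1) * (g u \<bullet> g v)) \<le> (f u \<bullet> f v)\<^sup>2 * - 1"
        by (intro mult_left_mono) auto
      then show ?thesis using \<open>u \<noteq> v\<close> by (simp add: mult_ac)
    next
      case no_arc: False
      then have "f u \<bullet> f v = 0"
        using f uv \<open>u \<noteq> v\<close> by (auto simp: orthonormal_rep_def)
      then show ?thesis using \<open>u \<noteq> v\<close> by simp
    qed
  qed
  have "0 \<le> (\<kappa> - 1) * (\<Sum>u\<in>?V. \<Sum>v\<in>?V. (f u \<bullet> f v)\<^sup>2 * (g u \<bullet> g v))"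
    using \<kappa>(1) sum_gram_Schur_product_nonneg[of ?V f d g m] f_carrier(1) g_carrier(1) by simp
  also have "\<dots> \<le> (\<Sum>u\<in>?V. \<Sum>v\<in>?V. (if v = u then \<kappa> else 0) - (f u \<bullet> f v)\<^sup>2)"
    unfolding sum_distrib_left by (intro sum_mono entry)
  also have "\<dots> = \<kappa> * real (card ?V) - ?S"
    using pair_finite_verts by (simp add: sum_subtractf)
  finally show ?thesis by simp
qed

theorem theorem8:
  fixes G :: "'a pair_pre_digraph" and n :: nat
  assumes "pair_graph G"
    and "pverts G \<noteq> {}"
    and "card (pverts G) = n"
  shows "vector_chromatic_number G \<ge> (lovasz_theta (graph_complement G))\<^sup>2 / real n"
proof -
  interpret pair_graph G by fact
  let ?V = "pverts G"
  let ?L = "{largest_eigenvalue ?V (gram_matrix f) | d f. orthonormal_rep d G f}"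
  have theta: "lovasz_theta (graph_complement G) = Sup ?L"
    by (simp add: lovasz_theta_def orthonormal_rep_complement_complement)
      (simp add: graph_complement_def)
  have "n > 0" using assms(2,3) pair_finite_verts by (auto simp: card_gt_0_iff)
  show ?thesis
    unfolding vector_chromatic_number_def
  proof (rule cInf_greatest)
    show "{\<kappa>. \<kappa> \<ge> 2 \<and> (\<exists>d f. unit_assignment d G f \<and>
        (\<forall>(u, v)\<in>parcs G. f u \<bullet> f v \<le> - 1 / (\<kappa> - 1)))} \<noteq> {}"
      using vector_colouring_exists[OF assms(1,2)] by auto
  next
    fix \<kappa> assume "\<kappa> \<in> {\<kappa>. \<kappa> \<ge> 2 \<and> (\<exists>d f. unit_assignment d G f \<and>
        (\<forall>(u, v)\<in>parcs G. f u \<bullet> f v \<le> - 1 / (\<kappa> - 1)))}"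
    then obtain m g where \<kappa>: "\<kappa> \<ge> 2" and g: "unit_assignment m G g"
      "\<And>u v. (u, v) \<in> parcs G \<Longrightarrow> g u \<bullet> g v \<le> - 1 / (\<kappa> - 1)"
      by blast
    (* A two-sided bound passes to the supremum and from there to its square. *)
    have "\<bar>l\<bar> \<le> sqrt (\<kappa> * n)" if "l \<in> ?L" for l
    proof -
      obtain d f where f: "orthonormal_rep d G f"
        and l: "l = largest_eigenvalue ?V (gram_matrix f)" using \<open>l \<in> ?L\<close> by blast
      have "gram_matrix f u v = gram_matrix f v u" if "u \<in> ?V" "v \<in> ?V" for u v
        using f that unfolding gram_matrix_def orthonormal_rep_def unit_assignment_def
        by (metis comm_scalar_prod)
      then have "indexed_eigenvalue ?V (gram_matrix f) l"
        unfolding l by (intro largest_eigenvalue_is_eigenvalue pair_finite_verts assms(2))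
      then have "l\<^sup>2 \<le> (\<Sum>u\<in>?V. \<Sum>v\<in>?V. (f u \<bullet> f v)\<^sup>2)"
        using eigenvalue_square_le_sum_squares[OF pair_finite_verts]
        by (fastforce simp: gram_matrix_def)
      also have "\<dots> \<le> \<kappa> * n"
        using sum_gram_squares_le[OF assms(1) f g(1) \<kappa> g(2)] assms(3) by simp
      finally show ?thesis by (simp add: real_le_rsqrt)
    qed
    moreover have "?L \<noteq> {}"
      using orthonormal_rep_exists[OF pair_finite_verts] by blast
    ultimately have "\<bar>Sup ?L\<bar> \<le> sqrt (\<kappa> * n)"
      by (intro cSup_abs_le) auto
    then have "(Sup ?L)\<^sup>2 \<le> \<kappa> * n"
      using \<kappa> by (simp add: sqrt_ge_absD)
    then show "(lovasz_theta (graph_complement G))\<^sup>2 / real n \<le> \<kappa>"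
      unfolding theta using \<open>n > 0\<close> by (simp add: field_simps)
  qed
qed

end
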